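(* Fix any $\lambda\in(0,1)$, and assume $m=m_n$ satisfies $m=o(N)$ and $m\to\infty$ as $n\to\infty$, where $N=\binom n2$. Let $\mathcal H$ be the collection of all $m$-edge subgraphs of $K_n$, and let $\mathcal P=\mathrm{Bern}(\lambda)$ and $\mathcal Q=\mathrm{Bern}\left(\frac{(1-\lambda)m}{N-m}\right)$. Then $$D_{\mathrm{KL}}(\mathcal P\|\mathcal Q)=(\lambda+o(1))\log(p_{1M}^{-1}),$$ and, in the hidden weighted graph model, there exists an estimator $\hat H$ that recovers a $\lambda+o(1)$ fraction of the hidden edges with high probability, i.e. there is a sequence $\varepsilon_n\to0$ with $\Pr[|\hat H\cap H^*|\ge(\lambda+\varepsilon_n)m]\to1$.
   Context: Hidden weighted graph model: $K_n$ is the complete graph on $n$ labelled vertices, with $N=\binom n2$ edges; subgraphs are identified with their edge sets. A graph $H^*$ is drawn uniformly at random from $\mathcal H$; conditionally on $H^*$, the weights $A_e$ of the edges $e$ of $K_n$ are independent, with $A_e\sim\mathcal P$ if $e\in H^*$ and $A_e\sim\mathcal Q$ otherwise. An estimator $\hat H$ is a (possibly randomized) function of $A=(A_e)_e$ with values in $\mathcal H$. $M=|\mathcal H|$ (here $M=\binom Nm$) and $p_{1M}=M^{-1/m}$. $\mathrm{Bern}(q)$ is the Bernoulli distribution on $\{0,1\}$ with success probability $q$. $D_{\mathrm{KL}}$ is the Kullback–Leibler divergence with natural logarithm. *)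

theory Defs
  imports "HOL-Probability.Probability" "HOL-Library.Landau_Symbols"
begin

type_synonym edge = "nat set"

definition complete_graph :: "nat \<Rightarrow> edge set" where
  "complete_graph n = {e. e \<subseteq> {..<n} \<and> card e = 2}"

definition subgraphs_with_edges :: "nat \<Rightarrow> nat \<Rightarrow> edge set set" where
  "subgraphs_with_edges n m = {H. H \<subseteq> complete_graph n \<and> card H = m}"

definition p1M :: "edge set set \<Rightarrow> nat \<Rightarrow> real" where
  "p1M \<H> m = real (card \<H>) powr (- 1 / real m)"

text \<open>In the library, \<^term>\<open>KL_divergence b M N\<close> is the divergence of \<open>N\<close> relative to \<open>M\<close>,
  so the arguments have to be swapped. It is meaningful only if \<open>P\<close> is absolutely
  continuous with respect to \<open>Q\<close>.\<close>

definition D_KL :: "'w pmf \<Rightarrow> 'w pmf \<Rightarrow> real" where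
  "D_KL P Q = KL_divergence (exp 1) (measure_pmf Q) (measure_pmf P)"

text \<open>Joint law of the hidden graph and the weights; a weight function takes the value
  \<^const>\<open>undefined\<close> outside the edges of the complete graph. The collection \<open>\<H>\<close> must be
  finite and nonempty.\<close>

definition hidden_weighted_graph ::
    "nat \<Rightarrow> edge set set \<Rightarrow> 'w pmf \<Rightarrow> 'w pmf \<Rightarrow> (edge set \<times> (edge \<Rightarrow> 'w)) pmf" where
  "hidden_weighted_graph n \<H> P Q =
     bind_pmf (pmf_of_set \<H>) (\<lambda>H.
       map_pmf (\<lambda>A. (H, A))
         (Pi_pmf (complete_graph n) undefined (\<lambda>e. if e \<in> H then P else Q)))"

text \<open>A randomized estimator is a Markov kernel from weight functions to \<open>\<H>\<close>;
  deterministic estimators are the kernels of the form \<open>return_pmf \<circ> f\<close>.\<close>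

definition estimator :: "edge set set \<Rightarrow> ((edge \<Rightarrow> 'w) \<Rightarrow> edge set pmf) \<Rightarrow> bool" where
  "estimator \<H> est \<longleftrightarrow> (\<forall>A. set_pmf (est A) \<subseteq> \<H>)"

text \<open>Joint law of the hidden graph and its estimate, the latter depending on the hidden graph
  only through the weights.\<close>

definition hidden_and_estimate ::
    "nat \<Rightarrow> edge set set \<Rightarrow> 'w pmf \<Rightarrow> 'w pmf \<Rightarrow> ((edge \<Rightarrow> 'w) \<Rightarrow> edge set pmf)
      \<Rightarrow> (edge set \<times> edge set) pmf" where
  "hidden_and_estimate n \<H> P Q est =
     bind_pmf (hidden_weighted_graph n \<H> P Q) (\<lambda>(H, A). map_pmf (\<lambda>H'. (H, H')) (est A))"

end

theory Submission
  imports Defs "HOL-Real_Asymp.Real_Asymp"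
begin

text \<open>
  Let \<open>S\<close> be the set of edges of weight 1. The parameter of \<open>Q\<close> is chosen such that
  \<open>S\<close> has \<open>m\<close> elements on average, and the estimator is any \<open>m\<close>-set \<open>T\<close> with \<open>T \<subseteq> S\<close> or
  \<open>S \<subseteq> T\<close>. In the second case \<open>T\<close> meets the hidden graph \<open>H\<close> in at least \<open>|S \<inter> H|\<close> edges, in the
  first case in at least \<open>m - |S - H|\<close> edges. Both \<open>|S \<inter> H|\<close> and \<open>|S - H|\<close> are binomial, with means
  \<open>\<lambda> m\<close> and \<open>(1 - \<lambda>) m\<close> and variances at most \<open>m\<close>, so Chebyshev's inequality
  with deviation \<open>m\<^sup>3\<^sup>/\<^sup>4\<close> suffices. The divergence is evaluated explicitly and
  compared with the bounds \<open>(N/m)\<^sup>m \<le> C(N, m) \<le> (e N/m)\<^sup>m\<close>.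
\<close>

section \<open>Variance and tail of the binomial distribution\<close>

lemma binomial_pmf_second_central_moment:
  assumes "p \<in> {0..1}"
  shows "measure_pmf.expectation (binomial_pmf n p) (\<lambda>k. (real k - real n * p)\<^sup>2) = real n * p * (1 - p)"
proof (induction n)
  case 0
  show ?case using assms by (simp add: binomial_pmf_0)
next
  case (Suc n)
  let ?B = "binomial_pmf n p"
  have int: "integrable (measure_pmf ?B) (f :: nat \<Rightarrow> real)" for f
    using assms by simp
  have "measure_pmf.expectation (binomial_pmf (Suc n) p) (\<lambda>k. (real k - real (Suc n) * p)\<^sup>2)
     = measure_pmf.expectation (bernoulli_pmf p) (\<lambda>b. measure_pmf.expectation ?B
         (\<lambda>k. (real ((if b then 1 else 0) + k) - real (Suc n) * p)\<^sup>2))"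
    using assms finite_set_pmf_binomial_pmf[OF assms]
    unfolding binomial_pmf_Suc[OF assms] map_pmf_def[symmetric]
    by (subst pmf_expectation_bind[where A = UNIV]) (auto simp: UNIV_bool)
  also have "\<dots> = measure_pmf.expectation ?B (\<lambda>k. p * (real k + 1 - real (Suc n) * p)\<^sup>2
      + (1 - p) * (real k - real (Suc n) * p)\<^sup>2)"
    using assms int by (simp add: add.commute)
  \<comment> \<open>With \<open>a = k - n p\<close>, the two squares are those of
    \<open>a + (1 - p)\<close> and \<open>a - p\<close>. Their cross terms cancel in the average,
    which leaves the variance \<open>p (1 - p)\<close> of the new trial.\<close>
  also have "(\<lambda>k. p * (real k + 1 - real (Suc n) * p)\<^sup>2 + (1 - p) * (real k - real (Suc n) * p)\<^sup>2)
    = (\<lambda>k. (real k - real n * p)\<^sup>2 + p * (1 - p))"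
    by (simp add: fun_eq_iff algebra_simps power2_eq_square)
  also have "measure_pmf.expectation ?B \<dots> = real (Suc n) * p * (1 - p)"
    using int by (simp add: Suc distrib_right)
  finally show ?case .
qed

text \<open>Chebyshev's inequality, by applying Markov's inequality to the squared
  deviation.\<close>

lemma binomial_pmf_deviation:
  assumes "p \<in> {0..1}" "t > 0"
  shows "measure_pmf.prob (binomial_pmf n p) {k. t \<le> \<bar>real k - real n * p\<bar>} \<le> real n * p * (1 - p) / t\<^sup>2"
proof -
  have "measure_pmf.prob (binomial_pmf n p) {k. t \<le> \<bar>real k - real n * p\<bar>}
      = measure_pmf.prob (binomial_pmf n p)
          {k \<in> space (measure_pmf (binomial_pmf n p)). (real k - real n * p)\<^sup>2 \<ge> t\<^sup>2}"
    using assms(2) by (simp add: abs_le_square_iff[symmetric])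
  also have "\<dots> \<le> measure_pmf.expectation (binomial_pmf n p) (\<lambda>k. (real k - real n * p)\<^sup>2) / t\<^sup>2"
    using assms by (intro integral_Markov_inequality_measure[where A = "{}"]) auto
  finally show ?thesis
    using assms by (simp add: binomial_pmf_second_central_moment)
qed

section \<open>Bernoulli divergence and the size of binomial coefficients\<close>

text \<open>Both laws have densities with respect to counting measure on \<open>bool\<close>. The
  density of the second is positive at both points, which gives absolute continuity, and the
  integral is a sum of two terms.\<close>

lemma D_KL_bernoulli:
  assumes "0 < p" "p < 1" "0 < q" "q < 1"
  shows "D_KL (bernoulli_pmf p) (bernoulli_pmf q) = p * ln (p / q) + (1 - p) * ln ((1 - p) / (1 - q))"
proof -
  interpret sigma_finite_measure "count_space (UNIV :: bool set)"
    by (rule sigma_finite_measure_count_space_finite) simp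
  have "D_KL (bernoulli_pmf p) (bernoulli_pmf q)
     = (\<integral>b. pmf (bernoulli_pmf p) b * log (exp 1) (pmf (bernoulli_pmf p) b / pmf (bernoulli_pmf q) b)
          \<partial>count_space UNIV)"
    unfolding D_KL_def measure_pmf_eq_density
    using assms by (intro KL_density_density) (auto simp: AE_count_space all_bool_eq)
  also have "\<dots> = p * ln (p / q) + (1 - p) * ln ((1 - p) / (1 - q))"
    using assms by (simp add: lebesgue_integral_count_space_finite UNIV_bool log_def)
  finally show ?thesis .
qed

lemma ln_binomial_lower:
  assumes "0 < k" "k \<le> n"
  shows "real k * ln (real n / real k) \<le> ln (real (n choose k))"
proof -
  have "real k * ln (real n / real k) = ln ((real n / real k) ^ k)"
    using assms by (simp add: ln_realpow)
  also have "\<dots> \<le> ln (real (n choose k))"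
    using assms binomial_ge_n_over_k_pow_k[of k n, where 'a = real]
    by (subst ln_le_cancel_iff) (auto simp: zero_less_binomial)
  finally show ?thesis .
qed

text \<open>Combines \<open>(n choose k) * k! \<le> n^k\<close> with
  \<open>k^k / k! \<le> exp k\<close>; the latter is the source of the summand 1.\<close>

lemma ln_binomial_upper:
  assumes "0 < k" "k \<le> n"
  shows "ln (real (n choose k)) \<le> real k * (ln (real n / real k) + 1)"
proof -
  \<comment> \<open>The left side is the term of index \<open>k\<close> in the exponential series at
    \<open>k\<close>.\<close>
  have "real k ^ k / fact k \<le> exp (real k)"
    using sums_le[OF _ sums_single[of k "\<lambda>i. real k ^ i / fact i"] exp_converges[of "real k"]]
    by (auto simp: field_simps)
  then have "real k ^ k \<le> exp (real k) * fact k"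
    by (simp add: field_simps)
  then have "real (n choose k) * real k ^ k \<le> real (n choose k) * (exp (real k) * fact k)"
    by (intro mult_left_mono) auto
  also have "\<dots> = exp (real k) * real ((n choose k) * fact k)"
    by simp
  also have "\<dots> \<le> exp (real k) * real (n ^ k)"
    by (intro mult_left_mono of_nat_mono binomial_fact_pow) auto
  finally have "real (n choose k) \<le> exp (real k) * (real n / real k) ^ k"
    using assms by (simp add: field_simps)
  then have "ln (real (n choose k)) \<le> ln (exp (real k) * (real n / real k) ^ k)"
    using assms by (subst ln_le_cancel_iff) (auto simp: zero_less_binomial)
  also have "\<dots> = real k * (ln (real n / real k) + 1)"
    using assms by (simp add: ln_mult ln_realpow algebra_simps)
  finally show ?thesis .
qed

section \<open>Sets comparable under inclusion\<close>

lemma exists_comparable_subset_with_card: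
  assumes "finite E" "S \<subseteq> E" "k \<le> card E"
  obtains T where "T \<subseteq> E" "card T = k" "T \<subseteq> S \<or> S \<subseteq> T"
proof (cases "k \<le> card S")
  case True
  then show ?thesis
    using obtain_subset_with_card_n[of k S] assms(2) that by (metis subset_trans)
next
  case False
  then show ?thesis
    using exists_subset_between[of S k E] assms that by auto
qed

text \<open>If \<open>T\<close> lies inside \<open>S\<close>, the elements of \<open>T\<close> that
  miss \<open>H\<close> all belong to \<open>S - H\<close>, and \<open>T\<close> has as many
  elements as \<open>H\<close>. Truncated subtraction is harmless: where it cuts off, the bound is
  0.\<close>

lemma card_Int_comparable:
  assumes "finite H" "finite T" "finite S" "card T = card H" "T \<subseteq> S \<or> S \<subseteq> T"
  shows "min (card (S \<inter> H)) (card H - card (S - H)) \<le> card (T \<inter> H)"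
  using assms(5)
proof
  assume "S \<subseteq> T"
  then have "card (S \<inter> H) \<le> card (T \<inter> H)"
    using assms by (intro card_mono) auto
  then show ?thesis by simp
next
  assume "T \<subseteq> S"
  then have "card (T - H) \<le> card (S - H)"
    using assms by (intro card_mono) auto
  moreover have "card H = card (T \<inter> H) + card (T - H)"
    using assms card_Int_Diff[of T H] by simp
  ultimately show ?thesis by simp
qed

section \<open>Counts under product laws, and mixtures\<close>

text \<open>Marginalising to \<open>B\<close> leaves i.i.d. coordinates. Factors outside
  \<open>B\<close> may have other laws, so the counts on the hidden edges and on the remaining edges
  can both be read off the same product.\<close>

lemma map_pmf_card_Pi_bernoulli:
  assumes "finite E" "B \<subseteq> E" "p \<in> {0..1}" "\<And>e. e \<in> B \<Longrightarrow> D e = bernoulli_pmf p"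
  shows "map_pmf (\<lambda>A. card {e \<in> B. A e}) (Pi_pmf E dflt D) = binomial_pmf (card B) p"
proof -
  have "binomial_pmf (card B) p = map_pmf (\<lambda>A. card {e \<in> B. A e}) (Pi_pmf B dflt (\<lambda>_. bernoulli_pmf p))"
    using assms finite_subset by (intro binomial_pmf_altdef') auto
  also have "Pi_pmf B dflt (\<lambda>_. bernoulli_pmf p) = Pi_pmf B dflt D"
    using assms by (intro Pi_pmf_cong) auto
  also have "\<dots> = map_pmf (\<lambda>f x. if x \<in> B then f x else dflt) (Pi_pmf E dflt D)"
    using assms by (intro Pi_pmf_subset) auto
  also have "map_pmf (\<lambda>A. card {e \<in> B. A e}) \<dots> = map_pmf (\<lambda>A. card {e \<in> B. A e}) (Pi_pmf E dflt D)"
    by (auto simp: pmf.map_comp o_def intro!: map_pmf_cong arg_cong[where f = card])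
  finally show ?thesis ..
qed

text \<open>Carries a bound that holds for each fixed hidden graph over to the random one.\<close>

lemma measure_bind_pmf_ge:
  assumes "\<And>x. x \<in> set_pmf M \<Longrightarrow> c \<le> measure_pmf.prob (f x) S"
  shows "c \<le> measure_pmf.prob (bind_pmf M f) S"
proof -
  \<comment> \<open>A negative \<open>c\<close> is truncated to 0 by \<open>ennreal\<close>; the
    final comparison still gives the claim, since probabilities are nonnegative.\<close>
  have "ennreal c = (\<integral>\<^sup>+ x. ennreal c \<partial>measure_pmf M)"
    by (simp add: measure_pmf.emeasure_space_1[simplified])
  also have "\<dots> \<le> (\<integral>\<^sup>+ x. emeasure (measure_pmf (f x)) S \<partial>measure_pmf M)"
    using assms by (intro nn_integral_mono_AE)
      (auto simp: AE_measure_pmf_iff measure_pmf.emeasure_eq_measure intro: ennreal_leI)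
  also have "\<dots> = ennreal (measure_pmf.prob (bind_pmf M f) S)"
    by (simp flip: measure_pmf.emeasure_eq_measure)
  finally show ?thesis by simp
qed

section \<open>The collection of subgraphs and the scale of the divergence\<close>

lemma finite_complete_graph [simp]: "finite (complete_graph n)"
  unfolding complete_graph_def by (rule finite_subset[of _ "Pow {..<n}"]) auto

lemma card_complete_graph: "card (complete_graph n) = n choose 2"
  unfolding complete_graph_def by (simp add: n_subsets)

lemma finite_subgraphs_with_edges: "finite (subgraphs_with_edges n k)"
  unfolding subgraphs_with_edges_def by (rule finite_subset[of _ "Pow (complete_graph n)"]) auto

lemma card_subgraphs_with_edges: "card (subgraphs_with_edges n k) = (n choose 2) choose k"
  unfolding subgraphs_with_edges_def by (simp add: n_subsets card_complete_graph)


lemma ln_inverse_p1M: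
  assumes "0 < k" "k \<le> n choose 2"
  shows "ln (inverse (p1M (subgraphs_with_edges n k) k)) = ln (real ((n choose 2) choose k)) / real k"
  using assms unfolding p1M_def card_subgraphs_with_edges
  by (simp add: ln_inverse ln_powr zero_less_binomial)

text \<open>With \<open>x = N/m\<close> the parameter of \<open>Q\<close> is
  \<open>(1 - lam) / (x - 1)\<close>, so the numerator is the divergence. Its first summand grows
  like \<open>lam * ln x\<close>, while the second stays bounded.\<close>

lemma D_KL_planted_asymptotics:
  fixes lam :: real
  assumes "0 < lam" "lam < 1"
  shows "((\<lambda>x. (lam * ln (lam / ((1 - lam) / (x - 1)))
            + (1 - lam) * ln ((1 - lam) / (1 - (1 - lam) / (x - 1)))) / ln x) \<longlongrightarrow> lam) at_top"
  using assms by real_asymp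

section \<open>The estimator and its overlap with the hidden graph\<close>

text \<open>An arbitrary choice suffices, because the overlap bound uses only size and
  comparability.\<close>

definition comparable_subgraph :: "nat \<Rightarrow> nat \<Rightarrow> (edge \<Rightarrow> bool) \<Rightarrow> edge set" where
  "comparable_subgraph n k A = (SOME T. T \<in> subgraphs_with_edges n k \<and>
     (T \<subseteq> {e \<in> complete_graph n. A e} \<or> {e \<in> complete_graph n. A e} \<subseteq> T))"

lemma comparable_subgraph:
  assumes "k \<le> n choose 2"
  shows "comparable_subgraph n k A \<in> subgraphs_with_edges n k"
    and "comparable_subgraph n k A \<subseteq> {e \<in> complete_graph n. A e} \<or>
         {e \<in> complete_graph n. A e} \<subseteq> comparable_subgraph n k A"
proof -
  obtain T where "T \<subseteq> complete_graph n" "card T = k"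
      "T \<subseteq> {e \<in> complete_graph n. A e} \<or> {e \<in> complete_graph n. A e} \<subseteq> T"
    using exists_comparable_subset_with_card[of "complete_graph n" "{e \<in> complete_graph n. A e}" k] assms
    by (auto simp: card_complete_graph)
  then have "\<exists>T. T \<in> subgraphs_with_edges n k \<and>
     (T \<subseteq> {e \<in> complete_graph n. A e} \<or> {e \<in> complete_graph n. A e} \<subseteq> T)"
    by (auto simp: subgraphs_with_edges_def)
  from someI_ex[OF this]
  show "comparable_subgraph n k A \<in> subgraphs_with_edges n k"
    and "comparable_subgraph n k A \<subseteq> {e \<in> complete_graph n. A e} \<or>
         {e \<in> complete_graph n. A e} \<subseteq> comparable_subgraph n k A"
    unfolding comparable_subgraph_def by blast+
qed

lemma estimator_comparable_subgraph:
  assumes "subgraphs_with_edges n k \<noteq> {}"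
  shows "estimator (subgraphs_with_edges n k) (\<lambda>A. return_pmf (comparable_subgraph n k A))"
proof -
  have "k \<le> n choose 2"
    using assms finite_subgraphs_with_edges[of n k]
    by (metis card_subgraphs_with_edges binomial_eq_0 card_0_eq not_le)
  then show ?thesis
    by (simp add: estimator_def comparable_subgraph)
qed

text \<open>Brings the draw of the hidden graph to the outside, so that it can be fixed by
  \<open>measure_bind_pmf_ge\<close>.\<close>

lemma hidden_and_estimate_return_pmf:
  "hidden_and_estimate n \<H> P Q (\<lambda>A. return_pmf (f A)) =
     bind_pmf (pmf_of_set \<H>) (\<lambda>H. map_pmf (\<lambda>A. (H, f A))
       (Pi_pmf (complete_graph n) undefined (\<lambda>e. if e \<in> H then P else Q)))"
  by (simp add: hidden_and_estimate_def hidden_weighted_graph_def bind_assoc_pmf bind_map_pmf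
      map_pmf_def bind_return_pmf)

text \<open>For a fixed hidden graph, two binomial counts govern the overlap. Each has variance at
  most \<open>k\<close>, so Chebyshev and a union bound give the failure probability
  \<open>2 k / t^2\<close>.\<close>

lemma comparable_subgraph_recovery:
  fixes lam q t :: real
  assumes "0 \<le> lam" "lam \<le> 1" "0 < t" "k < n choose 2" "0 \<le> q" "q \<le> 1"
    and q: "q * (real (n choose 2) - real k) = (1 - lam) * real k"
  shows "1 - 2 * real k / t\<^sup>2 \<le> measure_pmf.prob
    (hidden_and_estimate n (subgraphs_with_edges n k) (bernoulli_pmf lam) (bernoulli_pmf q)
      (\<lambda>A. return_pmf (comparable_subgraph n k A)))
    {(H, H'). lam * real k - t \<le> real (card (H' \<inter> H))}"
  unfolding hidden_and_estimate_return_pmf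
proof (rule measure_bind_pmf_ge)
  have ne: "subgraphs_with_edges n k \<noteq> {}"
    using comparable_subgraph(1)[of k n] assms by fastforce
  fix H assume "H \<in> set_pmf (pmf_of_set (subgraphs_with_edges n k))"
  then have H: "H \<subseteq> complete_graph n" "card H = k"
    using ne finite_subgraphs_with_edges[of n k] by (auto simp: subgraphs_with_edges_def)
  then have [simp]: "finite H"
    using finite_subset finite_complete_graph by blast
  define D where "D = (\<lambda>e. if e \<in> H then bernoulli_pmf lam else bernoulli_pmf q)"
  define W where "W = Pi_pmf (complete_graph n) undefined D"
  define X where "X = (\<lambda>A :: edge \<Rightarrow> bool. card {e \<in> H. A e})"
  define Y where "Y = (\<lambda>A. card {e \<in> complete_graph n - H. A e})"
  define F where "F = comparable_subgraph n k"
  have X: "map_pmf X W = binomial_pmf k lam"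
    unfolding X_def W_def H(2)[symmetric]
    using assms H by (intro map_pmf_card_Pi_bernoulli) (auto simp: D_def)
  have cardC: "card (complete_graph n - H) = (n choose 2) - k"
    using H by (simp add: card_Diff_subset card_complete_graph)
  have Y: "map_pmf Y W = binomial_pmf ((n choose 2) - k) q"
    unfolding Y_def W_def cardC[symmetric]
    using assms by (intro map_pmf_card_Pi_bernoulli) (auto simp: D_def)
  \<comment> \<open>The calibration of \<open>q\<close>: the edges of weight 1 outside
    \<open>H\<close> number \<open>(1 - lam) k\<close> on average, which makes up for those missing
    in \<open>H\<close>.\<close>
  have Ymean: "real ((n choose 2) - k) * q = (1 - lam) * real k"
    using assms by (simp add: of_nat_diff mult.commute)
  have overlap: "lam * real k - t \<le> real (card (F A \<inter> H))"
    if "\<bar>real (X A) - real k * lam\<bar> < t" "\<bar>real (Y A) - (1 - lam) * real k\<bar> < t" for A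
  proof -
    define S where "S = {e \<in> complete_graph n. A e}"
    have F: "F A \<subseteq> complete_graph n" "card (F A) = card H" "F A \<subseteq> S \<or> S \<subseteq> F A"
      using comparable_subgraph[of k n A] assms H
      by (auto simp: F_def S_def subgraphs_with_edges_def)
    have "S \<inter> H = {e \<in> H. A e}" "S - H = {e \<in> complete_graph n - H. A e}"
      using H by (auto simp: S_def)
    then have "min (X A) (k - Y A) \<le> card (F A \<inter> H)"
      using card_Int_comparable[of H "F A" S] F H finite_subset[OF F(1)]
      by (simp add: X_def Y_def S_def)
    \<comment> \<open>Both entries of the minimum exceed \<open>lam k - t\<close>; for the second,
      \<open>k - Y A > k - (1 - lam) k - t\<close>.\<close>
    with that show ?thesis
      by (auto simp: algebra_simps abs_less_iff min_def split: if_splits)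
  qed
  let ?BX = "{A. t \<le> \<bar>real (X A) - real k * lam\<bar>}"
  let ?BY = "{A. t \<le> \<bar>real (Y A) - (1 - lam) * real k\<bar>}"
  have "measure_pmf.prob W ?BX \<le> real k * lam * (1 - lam) / t\<^sup>2"
    using binomial_pmf_deviation[of lam t k] assms by (simp add: X[symmetric] vimage_def)
  also have "\<dots> \<le> real k / t\<^sup>2"
    using assms mult_left_mono[of "lam * (1 - lam)" 1 "real k"] mult_le_one[of lam "1 - lam"]
    by (intro divide_right_mono) (auto simp: mult.assoc)
  finally have BX: "measure_pmf.prob W ?BX \<le> real k / t\<^sup>2" .
  have "measure_pmf.prob W ?BY \<le> (1 - lam) * real k * (1 - q) / t\<^sup>2"
    using binomial_pmf_deviation[of q t "(n choose 2) - k", unfolded Ymean] assms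
    by (simp add: Y[symmetric] vimage_def)
  also have "\<dots> \<le> real k / t\<^sup>2"
  proof (intro divide_right_mono)
    have "(1 - lam) * (1 - q) \<le> 1"
      using assms by (intro mult_le_one) auto
    then show "(1 - lam) * real k * (1 - q) \<le> real k"
      using mult_left_mono[of "(1 - lam) * (1 - q)" 1 "real k"] by (simp add: mult_ac)
  qed auto
  finally have BY: "measure_pmf.prob W ?BY \<le> real k / t\<^sup>2" .
  \<comment> \<open>By \<open>overlap\<close>, failure forces at least one of the two counts to
    deviate by \<open>t\<close> or more.\<close>
  have "measure_pmf.prob W {A. \<not> lam * real k - t \<le> real (card (F A \<inter> H))} \<le> measure_pmf.prob W (?BX \<union> ?BY)"
    using overlap by (intro measure_pmf.finite_measure_mono) (auto simp: not_less[symmetric])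
  also have "\<dots> \<le> measure_pmf.prob W ?BX + measure_pmf.prob W ?BY"
    by (intro measure_Un_le) auto
  also have "\<dots> \<le> 2 * real k / t\<^sup>2"
    using BX BY by simp
  finally have "1 - 2 * real k / t\<^sup>2 \<le> measure_pmf.prob W {A. lam * real k - t \<le> real (card (F A \<inter> H))}"
    using measure_pmf.prob_compl[of "{A. lam * real k - t \<le> real (card (F A \<inter> H))}" W]
    by (simp add: Compl_eq_Diff_UNIV[symmetric] Collect_neg_eq)
  then show "1 - 2 * real k / t\<^sup>2 \<le> measure_pmf.prob
     (map_pmf (\<lambda>A. (H, comparable_subgraph n k A)) (Pi_pmf (complete_graph n) undefined
       (\<lambda>e. if e \<in> H then bernoulli_pmf lam else bernoulli_pmf q)))
     {(H, H'). lam * real k - t \<le> real (card (H' \<inter> H))}"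
    by (simp add: W_def D_def F_def vimage_def)
qed

section \<open>Asymptotics of the divergence and of the recovered fraction\<close>

theorem theorem5:
  fixes lam :: real and m :: "nat \<Rightarrow> nat"
  defines "N \<equiv> (\<lambda>n. n choose 2)"
  defines "\<H> \<equiv> (\<lambda>n. subgraphs_with_edges n (m n))"
  defines "P \<equiv> bernoulli_pmf lam"
  defines "Q \<equiv> (\<lambda>n. bernoulli_pmf ((1 - lam) * real (m n) / (real (N n) - real (m n))))"
  assumes "0 < lam" "lam < 1"
    and "(\<lambda>n. real (m n)) \<in> o(\<lambda>n. real (N n))"
    and "filterlim m at_top sequentially"
  shows "(\<exists>\<delta> :: nat \<Rightarrow> real. \<delta> \<longlonglongrightarrow> 0 \<and>
           (\<forall>\<^sub>F n in sequentially.
              D_KL P (Q n) = (lam + \<delta> n) * ln (inverse (p1M (\<H> n) (m n))))) \<and>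
         (\<exists>est \<epsilon>. (\<forall>n. \<H> n \<noteq> {} \<longrightarrow> estimator (\<H> n) (est n)) \<and>
           \<epsilon> \<longlonglongrightarrow> (0 :: real) \<and>
           (\<lambda>n. measure_pmf.prob (hidden_and_estimate n (\<H> n) P (Q n) (est n))
              {(H, H'). real (card (H' \<inter> H)) \<ge> (lam + \<epsilon> n) * real (m n)}) \<longlonglongrightarrow> 1)"
proof -
  define q where "q = (\<lambda>n. (1 - lam) * real (m n) / (real (N n) - real (m n)))"
  define x where "x = (\<lambda>n. real (N n) / real (m n))"
  define L where "L = (\<lambda>n. ln (inverse (p1M (\<H> n) (m n))))"
  have Q_q: "Q n = bernoulli_pmf (q n)" for n
    by (simp add: Q_def q_def)
  have m_pos: "\<forall>\<^sub>F n in sequentially. 0 < m n"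
    using assms(8) eventually_gt_at_top[of 0] by (auto simp: filterlim_iff)
  \<comment> \<open>The constant 1/3 gives \<open>N - m \<ge> 2 m\<close>, which with
    \<open>m > 0\<close> yields \<open>q n < 1\<close> and \<open>x n > 1\<close>.\<close>
  have small: "\<forall>\<^sub>F n in sequentially. real (m n) \<le> 1 / 3 * real (N n)"
    using landau_o.smallD[OF assms(7), of "1 / 3"] by simp
  have regular: "\<forall>\<^sub>F n in sequentially. 0 < m n \<and> m n < N n \<and> 0 < q n \<and> q n < 1 \<and> 1 < x n"
    using m_pos small
  proof eventually_elim
    case (elim n)
    have "(1 - lam) * real (m n) < real (m n)"
      using elim assms by simp
    with elim have "(1 - lam) * real (m n) < real (N n) - real (m n)"
      by linarith
    then show ?case
      using elim assms by (auto simp: q_def x_def field_simps)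
  qed
  have x_top: "filterlim x at_top sequentially"
    unfolding filterlim_at_top_gt[of x sequentially 0]
  proof safe
    fix Z :: real assume "0 < Z"
    then have "\<forall>\<^sub>F n in sequentially. real (m n) \<le> 1 / Z * real (N n)"
      using landau_o.smallD[OF assms(7), of "1 / Z"] by simp
    then show "\<forall>\<^sub>F n in sequentially. Z \<le> x n"
      using m_pos by eventually_elim (use \<open>0 < Z\<close> in \<open>simp add: x_def field_simps\<close>)
  qed
  have x_ln: "filterlim (\<lambda>n. ln (x n)) at_top sequentially"
    by (rule filterlim_compose[OF ln_at_top x_top])
  have D: "(\<lambda>n. D_KL P (Q n) / ln (x n)) \<longlonglongrightarrow> lam"
    using filterlim_compose[OF D_KL_planted_asymptotics[OF assms(5,6)] x_top]
  proof (rule Lim_transform_eventually)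
    show "\<forall>\<^sub>F n in sequentially. (lam * ln (lam / ((1 - lam) / (x n - 1)))
        + (1 - lam) * ln ((1 - lam) / (1 - (1 - lam) / (x n - 1)))) / ln (x n) = D_KL P (Q n) / ln (x n)"
      using regular
    proof eventually_elim
      case (elim n)
      have "q n = (1 - lam) / (x n - 1)"
        using elim by (simp add: q_def x_def field_simps)
      with elim show ?case
        using D_KL_bernoulli[OF assms(5,6), of "q n"] unfolding P_def Q_q by metis
    qed
  qed
  \<comment> \<open>The binomial bounds place \<open>L n\<close> between \<open>ln (x n)\<close> and
    \<open>ln (x n) + 1\<close>, so both the divergence and \<open>L\<close> can be measured against
    \<open>ln x\<close>.\<close>
  have L_bounds: "\<forall>\<^sub>F n in sequentially. 1 \<le> L n / ln (x n) \<and> L n / ln (x n) \<le> 1 + 1 / ln (x n)"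
    using regular
  proof eventually_elim
    case (elim n)
    then have L: "L n = ln (real (N n choose m n)) / real (m n)"
      using ln_inverse_p1M[of "m n" n] by (auto simp: L_def \<H>_def N_def)
    have "ln (x n) \<le> L n" "L n \<le> ln (x n) + 1"
      using ln_binomial_lower[of "m n" "N n"] ln_binomial_upper[of "m n" "N n"] elim
      by (auto simp: L x_def field_simps)
    moreover have "0 < ln (x n)"
      using elim by simp
    ultimately show ?case
      by (simp add: field_simps)
  qed
  have "(\<lambda>n. 1 + 1 / ln (x n)) \<longlonglongrightarrow> 1 + 0"
    by (intro tendsto_add tendsto_const
        tendsto_divide_0[OF tendsto_const filterlim_at_top_imp_at_infinity[OF x_ln]])
  then have upper: "(\<lambda>n. 1 + 1 / ln (x n)) \<longlonglongrightarrow> 1"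
    by simp
  have L: "(\<lambda>n. L n / ln (x n)) \<longlonglongrightarrow> 1"
  proof (rule tendsto_sandwich[OF _ _ tendsto_const upper])
    show "\<forall>\<^sub>F n in sequentially. 1 \<le> L n / ln (x n)"
      using L_bounds by (rule eventually_mono) simp
    show "\<forall>\<^sub>F n in sequentially. L n / ln (x n) \<le> 1 + 1 / ln (x n)"
      using L_bounds by (rule eventually_mono) simp
  qed
  have "(\<lambda>n. D_KL P (Q n) / L n - lam) \<longlonglongrightarrow> 0"
  proof -
    have "(\<lambda>n. (D_KL P (Q n) / ln (x n)) / (L n / ln (x n)) - lam)
        \<longlonglongrightarrow> lam / 1 - lam"
      by (intro tendsto_intros D L) auto
    moreover have "\<forall>\<^sub>F n in sequentially.
        (D_KL P (Q n) / ln (x n)) / (L n / ln (x n)) - lam = D_KL P (Q n) / L n - lam"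
      using regular by eventually_elim auto
    ultimately show ?thesis
      by (auto intro: Lim_transform_eventually)
  qed
  \<comment> \<open>The witness for \<delta> is \<open>D_KL P (Q n) / L n - lam\<close>; here
    \<open>L n\<close> is nonzero since its ratio to \<open>ln (x n)\<close> is at least 1.\<close>
  moreover have "\<forall>\<^sub>F n in sequentially. D_KL P (Q n) = (lam + (D_KL P (Q n) / L n - lam)) * L n"
    using L_bounds by eventually_elim (auto)
  ultimately have part1: "\<exists>\<delta> :: nat \<Rightarrow> real. \<delta> \<longlonglongrightarrow> 0 \<and>
      (\<forall>\<^sub>F n in sequentially. D_KL P (Q n) = (lam + \<delta> n) * ln (inverse (p1M (\<H> n) (m n))))"
    unfolding L_def by blast

  \<comment> \<open>This is \<open>-t / m\<close> for the deviation \<open>t = m powr (3/4)\<close>.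
    An exponent strictly between 1/2 and 1 makes both \<open>t / m\<close> and the failure bound
    \<open>2 m / t^2\<close> vanish.\<close>
  define \<epsilon> where "\<epsilon> = (\<lambda>n. - (real (m n) powr (-1/4)))"
  define est where "est = (\<lambda>n A. return_pmf (comparable_subgraph n (m n) A))"
  have m_top: "filterlim (\<lambda>n. real (m n)) at_top sequentially"
    using assms(8) by (rule filterlim_compose[OF filterlim_real_sequentially])
  have eps: "\<epsilon> \<longlonglongrightarrow> 0"
    unfolding \<epsilon>_def by (rule filterlim_compose[OF _ m_top]) real_asymp
  have "(\<lambda>n. measure_pmf.prob (hidden_and_estimate n (\<H> n) P (Q n) (est n))
      {(H, H'). real (card (H' \<inter> H)) \<ge> (lam + \<epsilon> n) * real (m n)}) \<longlonglongrightarrow> 1"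
  proof (rule tendsto_sandwich)
    show "\<forall>\<^sub>F n in sequentially. 1 - 2 * real (m n) powr (-1/2) \<le>
        measure_pmf.prob (hidden_and_estimate n (\<H> n) P (Q n) (est n))
          {(H, H'). real (card (H' \<inter> H)) \<ge> (lam + \<epsilon> n) * real (m n)}"
      using regular
    proof eventually_elim
      case (elim n)
      define t where "t = real (m n) powr (3/4)"
      have "t\<^sup>2 = real (m n) powr (3/2)"
        by (simp add: t_def power2_eq_square flip: powr_add)
      then have t2: "2 * real (m n) / t\<^sup>2 = 2 * real (m n) powr (-1/2)"
        using elim powr_diff[of "real (m n)" 1 "3/2"] by simp
      have "0 < t"
        using elim by (simp add: t_def)
      have "real (m n) powr (-1/4) * real (m n) = t"
        using elim powr_add[of "real (m n)" "-1/4" 1] by (simp add: t_def)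
      then have "(lam + \<epsilon> n) * real (m n) = lam * real (m n) - t"
        by (simp add: \<epsilon>_def algebra_simps)
      moreover have "q n * (real (n choose 2) - real (m n)) = (1 - lam) * real (m n)"
        using elim by (simp add: q_def N_def)
      ultimately show ?case
        using comparable_subgraph_recovery[of lam t "m n" n "q n"] elim assms(5,6) t2 \<open>0 < t\<close>
        by (simp add: est_def P_def Q_q \<H>_def N_def)
    qed
    show "(\<lambda>n. 1 - 2 * real (m n) powr (-1/2)) \<longlonglongrightarrow> 1"
      by (rule filterlim_compose[OF _ m_top]) real_asymp
  qed (auto simp: measure_pmf.prob_le_1)
  moreover have "\<forall>n. \<H> n \<noteq> {} \<longrightarrow> estimator (\<H> n) (est n)"
    unfolding \<H>_def est_def using estimator_comparable_subgraph by blast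
  ultimately show ?thesis
    using part1 eps by blast
qed

end
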